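(* Let $(L,\alpha)\in\mathcal K$. Define $$\bar g(s)=\xi'(s)+h^2-\int_0^s\frac{dq}{\big(L-\int_0^q\alpha(r)dr\big)^2},\quad s\in[0,1],\qquad g(u)=\int_u^1\bar g(s)ds,\quad u\in[0,1].$$ Let $\nu$ be the measure on $[0,1)$ induced by $\alpha$, i.e. $\nu([0,s])=\alpha(s)$ for $s\in[0,1)$, and let $S=\{u\in[0,1):g(u)=0\}$. Then $(L,\alpha)$ is the minimizer of $\mathcal Q$ over $\mathcal K$ if and only if $$\xi'(1)+h^2=\int_0^1\frac{dq}{\big(L-\int_0^q\alpha(r)dr\big)^2},$$ $\min_{u\in[0,1]}g(u)\ge0$, and $\nu(S)=\nu([0,1))$.
   Context: Let $(\gamma_p)_{p\ge2}$ be real numbers with $\sum_{p\ge2}2^p\gamma_p^2<\infty$, $h\in\mathbb R$, and $\xi(s)=\sum_{p\ge2}\gamma_p^2s^p$. $\mathcal N$ is the set of nonnegative, nondecreasing, right-continuous functions on $[0,1)$; $\mathcal K=\{(L,\alpha)\in(0,\infty)\times\mathcal N: L>\int_0^1\alpha(s)ds\}$; for $(L,\alpha)\in\mathcal K$, $$\mathcal Q(L,\alpha)=\frac12\Big((\xi'(1)+h^2)L-\int_0^1\xi''(q)\Big(\int_0^q\alpha(s)ds\Big)dq+\int_0^1\frac{dq}{L-\int_0^q\alpha(s)ds}\Big).$$ $\mathcal Q$ has a unique minimizer over $\mathcal K$ (this minimizer is what "the minimizer" refers to). *)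

theory Defs
  imports "HOL-Analysis.Analysis"
begin

definition xi :: "(nat \<Rightarrow> real) \<Rightarrow> real \<Rightarrow> real" where
  "xi \<gamma> s = (\<Sum>p. if 2 \<le> p then (\<gamma> p)\<^sup>2 * s ^ p else 0)"

definition inN :: "(real \<Rightarrow> real) \<Rightarrow> bool" where
  "inN \<alpha> \<longleftrightarrow> (\<forall>s\<in>{0..<1}. 0 \<le> \<alpha> s) \<and> mono_on {0..<1} \<alpha>
      \<and> (\<forall>s\<in>{0..<1}. continuous (at_right s) \<alpha>)"

definition inK :: "real \<Rightarrow> (real \<Rightarrow> real) \<Rightarrow> bool" where
  "inK L \<alpha> \<longleftrightarrow> 0 < L \<and> inN \<alpha> \<and> \<alpha> integrable_on {0..1} \<and> integral {0..1} \<alpha> < L"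

definition Qfun :: "(nat \<Rightarrow> real) \<Rightarrow> real \<Rightarrow> real \<Rightarrow> (real \<Rightarrow> real) \<Rightarrow> real" where
  "Qfun \<gamma> h L \<alpha> = (1/2) *
     ((deriv (xi \<gamma>) 1 + h\<^sup>2) * L
      - integral {0..1} (\<lambda>q. deriv (deriv (xi \<gamma>)) q * integral {0..q} \<alpha>)
      + integral {0..1} (\<lambda>q. 1 / (L - integral {0..q} \<alpha>)))"

text \<open>(L, alpha) is the minimizer of Q over K (the minimizer is unique, so this
  is equivalent to attaining the minimum).\<close>
definition is_minimizer :: "(nat \<Rightarrow> real) \<Rightarrow> real \<Rightarrow> real \<Rightarrow> (real \<Rightarrow> real) \<Rightarrow> bool" where
  "is_minimizer \<gamma> h L \<alpha> \<longleftrightarrow> inK L \<alpha> \<and>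
     (\<forall>L' \<alpha>'. inK L' \<alpha>' \<longrightarrow> Qfun \<gamma> h L \<alpha> \<le> Qfun \<gamma> h L' \<alpha>')"

definition gbar :: "(nat \<Rightarrow> real) \<Rightarrow> real \<Rightarrow> real \<Rightarrow> (real \<Rightarrow> real) \<Rightarrow> real \<Rightarrow> real" where
  "gbar \<gamma> h L \<alpha> s = deriv (xi \<gamma>) s + h\<^sup>2
      - integral {0..s} (\<lambda>q. 1 / (L - integral {0..q} \<alpha>)\<^sup>2)"

definition gfun :: "(nat \<Rightarrow> real) \<Rightarrow> real \<Rightarrow> real \<Rightarrow> (real \<Rightarrow> real) \<Rightarrow> real \<Rightarrow> real" where
  "gfun \<gamma> h L \<alpha> u = integral {u..1} (gbar \<gamma> h L \<alpha>)"

end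

theory Submission
  imports Defs
begin

text \<open>
  Write \<open>A(q) = \<integral>\<^sub>0\<^sup>q \<alpha>\<close> and \<open>B = L - A\<close>. The functional \<open>Q\<close> is convex in \<open>(L, \<alpha>)\<close>, the only nonlinear
  term being \<open>\<integral> 1/B\<close>, so \<open>(L, \<alpha>)\<close> is a minimizer iff every directional derivative towards a point
  \<open>(L', \<alpha>')\<close> of \<open>\<K>\<close> is nonnegative. Integration by parts turns twice this derivative into
  \<open>gbar(1) (B'(1) - B(1)) + \<integral> gbar \<alpha>' - \<integral> gbar \<alpha>\<close>, and by Fubini \<open>\<integral> gbar \<alpha> = \<integral> g d\<nu>\<close>.

  Varying \<open>L\<close> gives \<open>gbar(1) = 0\<close>, adding multiples of the indicator of \<open>[u, 1]\<close> to \<open>\<alpha>\<close> gives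
  \<open>g(u) \<ge> 0\<close>, and \<open>\<alpha>' = 0\<close> gives \<open>\<integral> g d\<nu> = 0\<close>. Conversely, these three properties make the derivative
  equal to \<open>\<integral> gbar \<alpha>'\<close>, which is nonnegative by the second mean value theorem since \<open>g \<ge> 0\<close>.
\<close>

section \<open>The function \<open>\<xi>\<close> and the class \<open>\<N>\<close>\<close>

text \<open>The hypothesis gives convergence of the power series at 2, so it can be differentiated
  termwise on the open disc of radius 2, which contains \<open>{0..1}\<close>. \<open>X\<close> is
  the third derivative of \<open>xi \<gamma>\<close>; its continuity later makes the second
  derivative Lipschitz.\<close>

lemma xi_three_derivatives:
  assumes "summable (\<lambda>p. 2 ^ p * (\<gamma> p)\<^sup>2)"
  obtains X where
    "\<And>x. \<bar>x\<bar> < 2 \<Longrightarrow> (deriv (xi \<gamma>) has_real_derivative deriv (deriv (xi \<gamma>)) x) (at x)"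
    "\<And>x. \<bar>x\<bar> < 2 \<Longrightarrow> (deriv (deriv (xi \<gamma>)) has_real_derivative X x) (at x)"
    "\<And>x. \<bar>x\<bar> < 2 \<Longrightarrow> isCont X x"
proof -
  define c where "c p = (if 2 \<le> p then (\<gamma> p)\<^sup>2 else 0)" for p :: nat
  define X where "X k x = (\<Sum>n. (diffs ^^ k) c n * x ^ n)" for k :: nat and x :: real
  have xi: "xi \<gamma> = X 0"
    by (auto simp: xi_def X_def c_def fun_eq_iff intro!: suminf_cong)
  have "summable (\<lambda>n. c n * 2 ^ n)"
    by (rule summable_comparison_test[OF _ assms]) (auto simp: c_def intro!: exI[of _ 0])
  then have "summable (\<lambda>n. c n * x ^ n)" if "norm x < 2" for x :: real
    using powser_inside[of c 2 x] that by simp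
  then have sm: "summable (\<lambda>n. (diffs ^^ k) c n * x ^ n)" if "norm x < 2" for x :: real and k
    using that
  proof (induction k arbitrary: x)
    case (Suc k)
    then show ?case using termdiff_converges[of x 2 "(diffs ^^ k) c"] by auto
  qed auto
  have D: "(X k has_real_derivative X (Suc k) x) (at x)" if "\<bar>x\<bar> < 2" for k x
    using termdiffs_strong'[of 2 "(diffs ^^ k) c" x] sm that by (auto simp: X_def[abs_def])
  \<comment> \<open>\<open>deriv\<close> depends on values near the point, so the formula for one
    derivative passes to the next only through eventual equality on the open disc.\<close>
  have ev: "\<forall>\<^sub>F y in nhds x. \<bar>y\<bar> < 2" if "\<bar>x\<bar> < 2" for x :: real
    using that eventually_nhds_in_open[of "ball 0 2" x] by (simp add: dist_real_def)
  have X1: "deriv (X k) x = X (Suc k) x" if "\<bar>x\<bar> < 2" for k x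
    using D[OF that] by (rule DERIV_imp_deriv)
  have X2: "deriv (deriv (X 0)) x = X 2 x" if "\<bar>x\<bar> < 2" for x
  proof -
    have "deriv (deriv (X 0)) x = deriv (X 1) x"
      using ev[OF that] by (intro deriv_cong_ev) (auto elim!: eventually_mono simp: X1)
    then show ?thesis using X1[OF that, of 1] by (simp add: numeral_2_eq_2)
  qed
  show ?thesis
  proof
    fix x :: real assume x: "\<bar>x\<bar> < 2"
    have "(deriv (X 0) has_real_derivative X 2 x) (at x)"
      using D[OF x, of 1] ev[OF x]
      by (subst DERIV_cong_ev[OF refl _ refl, of _ "X 1"])
        (auto elim!: eventually_mono simp: X1 numeral_2_eq_2)
    then show "(deriv (xi \<gamma>) has_real_derivative deriv (deriv (xi \<gamma>)) x) (at x)"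
      by (simp add: xi X2 x)
    have "(deriv (deriv (X 0)) has_real_derivative X 3 x) (at x)"
      using D[OF x, of 2] ev[OF x]
      by (subst DERIV_cong_ev[OF refl _ refl, of _ "X 2"])
        (auto elim!: eventually_mono simp: X2 numeral_2_eq_2 numeral_3_eq_3)
    then show "(deriv (deriv (xi \<gamma>)) has_real_derivative X 3 x) (at x)"
      by (simp add: xi)
    show "isCont (X 3) x"
      using D[OF x] by (rule DERIV_isCont)
  qed
qed

text \<open>Members of \<open>inN\<close> are constrained only on \<open>{0..<1}\<close>, so their
  value at 1 is arbitrary. Overwriting the value at the right endpoint by \<open>c\<close> leaves
  the integral unchanged.\<close>

lemma integral_ge_of_ge_on_half_open:
  fixes f :: "real \<Rightarrow> real"
  assumes "f integrable_on {a..b}" "a \<le> b" "\<And>s. a \<le> s \<Longrightarrow> s < b \<Longrightarrow> c \<le> f s"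
  shows "c * (b - a) \<le> integral {a..b} f"
proof -
  have "integral {a..b} (\<lambda>s. if s = b then c else f s) = integral {a..b} f"
    by (rule integral_spike[of "{b}"]) auto
  moreover have "(\<lambda>s. if s = b then c else f s) integrable_on {a..b}"
    by (rule integrable_spike[OF assms(1), of "{b}"]) auto
  ultimately have "integral {a..b} (\<lambda>_. c) \<le> integral {a..b} f"
    using integral_le[of "\<lambda>_. c" "{a..b}" "\<lambda>s. if s = b then c else f s"] assms(3) by fastforce
  then show ?thesis using assms(2) by (simp add: mult.commute)
qed

section \<open>Monotonicity, primitives and measurability for members of \<open>inN\<close>\<close>

context
  fixes \<alpha> :: "real \<Rightarrow> real"
  assumes N: "inN \<alpha>" and int: "\<alpha> integrable_on {0..1}"
begin

lemma inN_nonneg: "0 \<le> s \<Longrightarrow> s < 1 \<Longrightarrow> 0 \<le> \<alpha> s"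
  using N by (auto simp: inN_def)

lemma inN_mono: "0 \<le> s \<Longrightarrow> s \<le> t \<Longrightarrow> t < 1 \<Longrightarrow> \<alpha> s \<le> \<alpha> t"
  using N by (auto simp: inN_def mono_on_def)

lemma inN_integrable_on: "0 \<le> a \<Longrightarrow> b \<le> 1 \<Longrightarrow> \<alpha> integrable_on {a..b}"
  using integrable_on_subinterval[OF int] by auto

lemma inN_integral_diff:
  assumes "0 \<le> x" "x \<le> y" "y \<le> 1"
  shows "integral {0..y} \<alpha> - integral {0..x} \<alpha> = integral {x..y} \<alpha>"
  using Henstock_Kurzweil_Integration.integral_combine[of 0 x y \<alpha>] assms inN_integrable_on by simp

lemma inN_integral_diff_ge:
  assumes "0 \<le> x" "x < y" "y \<le> 1"
  shows "\<alpha> x * (y - x) \<le> integral {0..y} \<alpha> - integral {0..x} \<alpha>"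
  unfolding inN_integral_diff[OF assms(1) less_imp_le[OF assms(2)] assms(3)]
  using assms by (intro integral_ge_of_ge_on_half_open inN_integrable_on inN_mono) auto

lemma inN_integral_mono:
  assumes "0 \<le> x" "x \<le> y" "y \<le> 1"
  shows "integral {0..x} \<alpha> \<le> integral {0..y} \<alpha>"
proof (cases "x = y")
  case False
  then have "0 \<le> \<alpha> x * (y - x)" using assms inN_nonneg[of x] by simp
  then show ?thesis using inN_integral_diff_ge[of x y] assms False by simp
qed simp

lemma inN_integral_nonneg: "0 \<le> q \<Longrightarrow> q \<le> 1 \<Longrightarrow> 0 \<le> integral {0..q} \<alpha>"
  using inN_integral_mono[of 0 q] by simp

lemma inN_continuous_integral: "continuous_on {0..1} (\<lambda>q. integral {0..q} \<alpha>)"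
  using indefinite_integral_continuous_1[OF int] .

lemma inN_borel_measurable: "(\<lambda>s. indicator {0..<1} s * \<alpha> s) \<in> borel_measurable borel"
proof -
  have "\<alpha> \<in> borel_measurable (restrict_space borel {0..<1})"
    using N by (intro borel_measurable_mono_on_fnc) (simp add: inN_def)
  then show ?thesis
    by (subst (asm) borel_measurable_restrict_space_iff) (auto simp: mult.commute)
qed

text \<open>A bridge from the gauge integral to the Lebesgue integral. Cutting at
  \<open>{0..<q}\<close> removes the uncontrolled value at 1, so the integrand is nonnegative and
  Borel on the whole line; only the null set \<open>{q}\<close> is lost.\<close>

lemma inN_nn_integral:
  assumes "0 \<le> q" "q \<le> 1"
  shows "(\<integral>\<^sup>+s. ennreal (indicator {0..<q} s * \<alpha> s) \<partial>lborel) = ennreal (integral {0..q} \<alpha>)"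
proof (rule nn_integral_has_integral_lborel)
  have "(\<lambda>s. indicator {0..<q} s * (indicator {0..<1} s * \<alpha> s)) \<in> borel_measurable borel"
    using inN_borel_measurable by measurable
  also have "(\<lambda>s. indicator {0..<q} s * (indicator {0..<1} s * \<alpha> s)) = (\<lambda>s. indicator {0..<q} s * \<alpha> s)"
    using assms by (auto simp: fun_eq_iff indicator_def)
  finally show "(\<lambda>s. indicator {0..<q} s * \<alpha> s) \<in> borel_measurable borel" .
  show "0 \<le> indicator {0..<q} s * \<alpha> s" for s
    using assms inN_nonneg[of s] by (auto simp: indicator_def)
  have "(\<alpha> has_integral integral {0..q} \<alpha>) {0..q}"
    using inN_integrable_on[of 0 q] assms by (simp add: has_integral_integral)
  then have "((\<lambda>s. if s \<in> {0..q} then \<alpha> s else 0) has_integral integral {0..q} \<alpha>) UNIV"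
    by (simp only: has_integral_restrict_UNIV)
  then show "((\<lambda>s. indicator {0..<q} s * \<alpha> s) has_integral integral {0..q} \<alpha>) UNIV"
    by (rule has_integral_spike[of "{q}", rotated 2]) (auto simp: indicator_def)
qed

end

section \<open>Integrals against distribution functions\<close>

lemma space_borel_unit:
  assumes "sets M = sets (restrict_space borel {0..<1::real})"
  shows "space M = {0..<1}"
  using sets_eq_imp_space_eq[OF assms] by (simp add: space_restrict_space)

lemma sets_borel_unit:
  assumes "sets M = sets (restrict_space borel {0..<1::real})" "A \<in> sets borel" "A \<subseteq> {0..<1}"
  shows "A \<in> sets M"
  using assms by (auto simp: sets_restrict_space)

lemma Icc_unit_subset: "{0..1 - 1 / real (Suc n)} \<subseteq> {0..<1}"
proof
  fix u assume "u \<in> {0..1 - 1 / real (Suc n)}"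
  moreover have "0 < 1 / real (Suc n)" by simp
  ultimately show "u \<in> {0..<1}" unfolding atLeastAtMost_iff atLeastLessThan_iff by linarith
qed

lemma Union_Icc_unit: "(\<Union>n. {0..1 - 1 / real (Suc n)}) = {0..<1}"
proof (rule equalityI)
  show "(\<Union>n. {0..1 - 1 / real (Suc n)}) \<subseteq> {0..<1}"
    using Icc_unit_subset by blast
  show "{0..<1} \<subseteq> (\<Union>n. {0..1 - 1 / real (Suc n)})"
  proof
    fix u :: real assume u: "u \<in> {0..<1}"
    then obtain n where "inverse (real (Suc n)) < 1 - u"
      using reals_Archimedean[of "1 - u"] by auto
    then have "u \<in> {0..1 - 1 / real (Suc n)}"
      using u by (simp add: inverse_eq_divide del: of_nat_Suc)
    then show "u \<in> (\<Union>n. {0..1 - 1 / real (Suc n)})" by blast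
  qed
qed

text \<open>Continuity from below along the intervals \<open>{0..1 - 1 / real (Suc n)}\<close>,
  which exhaust \<open>{0..<1}\<close>.\<close>

lemma distribution_finite_of_bounded:
  fixes M :: "real measure"
  assumes sets: "sets M = sets (restrict_space borel {0..<1})"
    and cdf: "\<And>q. 0 \<le> q \<Longrightarrow> q < 1 \<Longrightarrow> emeasure M {0..q} = ennreal (F q)"
    and bound: "\<And>q. 0 \<le> q \<Longrightarrow> q < 1 \<Longrightarrow> F q \<le> c"
  shows "emeasure M {0..<1} < \<infinity>"
proof -
  let ?I = "\<lambda>n. {0..1 - 1 / real (Suc n)}"
  have "incseq ?I"
    by (auto simp: incseq_def frac_le)
  moreover have "?I n \<in> sets M" for n
    by (intro sets_borel_unit[OF sets] Icc_unit_subset) simp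
  then have "range ?I \<subseteq> sets M" by auto
  ultimately have "(SUP n. emeasure M (?I n)) = emeasure M {0..<1}"
    unfolding Union_Icc_unit[symmetric] by (intro SUP_emeasure_incseq)
  moreover have "(SUP n. emeasure M (?I n)) \<le> ennreal c"
    by (intro SUP_least) (auto simp: cdf intro!: ennreal_leI bound)
  ultimately show ?thesis
    using le_less_trans[OF _ ennreal_less_top] by simp
qed

lemma continuous_on_unit_interval_bound:
  fixes k :: "real \<Rightarrow> real"
  assumes "continuous_on {0..1} k"
  obtains C where "0 \<le> C" "\<And>q. 0 \<le> q \<Longrightarrow> q \<le> 1 \<Longrightarrow> \<bar>k q\<bar> \<le> C"
proof -
  have "bounded (k ` {0..1})"
    using assms by (intro compact_imp_bounded compact_continuous_image) auto
  then obtain C where C: "\<forall>q\<in>{0..1}. \<bar>k q\<bar> \<le> C"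
    by (auto simp: bounded_iff)
  moreover have "0 \<le> C"
    using C[rule_format, of 0] by force
  ultimately show ?thesis using that[of C] by auto
qed

text \<open>Fubini for \<open>k q\<close> on the triangle u \<le> q: integrating out u first leaves
  \<open>k q * F q\<close>, integrating out q first leaves the tail integral of \<open>k\<close>. It
  serves twice: for \<nu> with \<open>F\<close> = \<alpha>, and for the measure with density
  \<alpha>, where \<open>F\<close> is the primitive of \<alpha>.\<close>

lemma integral_against_distribution_function:
  fixes M :: "real measure" and F k :: "real \<Rightarrow> real"
  assumes sets: "sets M = sets (restrict_space borel {0..<1})"
    and cdf: "\<And>q. 0 \<le> q \<Longrightarrow> q < 1 \<Longrightarrow> emeasure M {0..q} = ennreal (F q)"
    and F: "(\<lambda>q. indicator {0..<1} q * F q) \<in> borel_measurable borel"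
      "\<And>q. 0 \<le> q \<Longrightarrow> q < 1 \<Longrightarrow> 0 \<le> F q"
      "(\<integral>\<^sup>+q. ennreal (indicator {0..<1} q * F q) \<partial>lborel) < \<infinity>"
    and k: "continuous_on {0..1} k"
  shows "integrable M (\<lambda>u. integral {u..1} k)"
    and "integral {0..1} (\<lambda>q. k q * F q) = (\<integral>u. integral {u..1} k \<partial>M)"
proof -
  note space = space_borel_unit[OF sets] and in_sets = sets_borel_unit[OF sets]
  interpret M: sigma_finite_measure M
  proof
    \<comment> \<open>The total mass is infinite when \<open>F\<close> is unbounded near 1, but each
      of the exhausting intervals has finite mass.\<close>
    define A where "A = range (\<lambda>n. {0..1 - 1 / real (Suc n)})"
    have "\<Union>A = space M"
      unfolding A_def space by (rule Union_Icc_unit)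
    moreover have "{0..1 - 1 / real (Suc n)} \<in> sets M" for n
      by (intro in_sets Icc_unit_subset) simp
    then have "A \<subseteq> sets M" by (auto simp: A_def)
    moreover have "emeasure M a \<noteq> \<infinity>" if "a \<in> A" for a
      using that by (auto simp: A_def cdf)
    ultimately show "\<exists>A. countable A \<and> A \<subseteq> sets M \<and> \<Union> A = space M \<and> (\<forall>a\<in>A. emeasure M a \<noteq> \<infinity>)"
      by (intro exI[of _ A] conjI ballI) (simp_all add: A_def)
  qed
  interpret P: pair_sigma_finite M lborel ..
  have [measurable]: "(\<lambda>u. u) \<in> borel_measurable M"
    by (subst measurable_cong_sets[OF sets refl]) (rule measurable_restrict_space1, simp)
  \<comment> \<open>\<open>k\<close> is continuous only on \<open>{0..1}\<close>; the cut produces a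
    Borel function on the line and confines the q-integral to the unit interval.\<close>
  define k' where "k' q = indicator {0..<1} q * k q" for q
  have [measurable]: "k' \<in> borel_measurable borel"
  proof -
    have "(\<lambda>q. indicator {0..<1} q *\<^sub>R k q) \<in> borel_measurable borel"
      by (intro borel_measurable_continuous_on_indicator continuous_on_subset[OF k]) auto
    then show ?thesis by (simp add: k'_def[abs_def])
  qed
  define f where "f u q = (if u \<le> q then k' q else 0)" for u q
  have [measurable]: "case_prod f \<in> borel_measurable (M \<Otimes>\<^sub>M lborel)"
    unfolding f_def by measurable
  obtain C where C0: "0 \<le> C" and C: "\<And>q. 0 \<le> q \<Longrightarrow> q \<le> 1 \<Longrightarrow> \<bar>k q\<bar> \<le> C"
    using continuous_on_unit_interval_bound[OF k] by blast
  have inner: "(\<integral>\<^sup>+u. ennreal (norm (f u q)) \<partial>M) = ennreal \<bar>k' q\<bar> * ennreal (indicator {0..<1} q * F q)" for q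
  proof (cases "q \<in> {0..<1}")
    case True
    have "(\<integral>\<^sup>+u. ennreal (norm (f u q)) \<partial>M) = (\<integral>\<^sup>+u. ennreal \<bar>k' q\<bar> * indicator {0..q} u \<partial>M)"
      by (rule nn_integral_cong) (auto simp: f_def space indicator_def)
    also have "\<dots> = ennreal \<bar>k' q\<bar> * emeasure M {0..q}"
      using True by (intro nn_integral_cmult_indicator in_sets) auto
    finally show ?thesis using True cdf by simp
  qed (auto simp: f_def k'_def cong: if_cong)
  \<comment> \<open>By Tonelli with q outermost, the integral of the absolute value is at most
    \<open>C\<close> times the integral of \<open>F\<close>, which is finite by hypothesis.\<close>
  have int: "integrable (M \<Otimes>\<^sub>M lborel) (case_prod f)"
  proof (rule integrableI_bounded)
    have "(\<integral>\<^sup>+x. ennreal (norm (case_prod f x)) \<partial>(M \<Otimes>\<^sub>M lborel))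
        = (\<integral>\<^sup>+q. \<integral>\<^sup>+u. ennreal (norm (f u q)) \<partial>M \<partial>lborel)"
      by (subst P.nn_integral_snd[symmetric]) (auto simp: split_beta')
    also have "\<dots> \<le> (\<integral>\<^sup>+q. ennreal C * ennreal (indicator {0..<1} q * F q) \<partial>lborel)"
      unfolding inner using C C0
      by (intro nn_integral_mono mult_right_mono ennreal_leI) (auto simp: k'_def indicator_def)
    also have "\<dots> < \<infinity>"
      using F by (subst nn_integral_cmult) (auto simp: ennreal_mult_less_top)
    finally show "(\<integral>\<^sup>+x. ennreal (norm (case_prod f x)) \<partial>(M \<Otimes>\<^sub>M lborel)) < \<infinity>" .
  qed measurable
  have fst: "(\<integral>q. f u q \<partial>lborel) = integral {u..1} k" if "u \<in> space M" for u
  proof -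
    have u: "0 \<le> u" "u < 1" using that by (auto simp: space)
    have cont: "continuous_on {u..1} k" using continuous_on_subset[OF k] u by auto
    have "(\<integral>q. f u q \<partial>lborel) = (LINT q:{u..1}|lborel. k q)"
      unfolding set_lebesgue_integral_def
    proof (rule integral_cong_AE)
      \<comment> \<open>\<open>k'\<close> vanishes at 1 while \<open>{u..1}\<close> contains that
        point; the two integrands differ only there.\<close>
      have "AE q in lborel. q \<noteq> 1" using AE_lborel_singleton[of 1] by auto
      then show "AE q in lborel. f u q = indicat_real {u..1} q *\<^sub>R k q"
        by eventually_elim (use u in \<open>auto simp: f_def k'_def indicator_def\<close>)
      show "(\<lambda>q. indicat_real {u..1} q *\<^sub>R k q) \<in> borel_measurable lborel"
        using borel_measurable_continuous_on_indicator[OF _ cont] by simp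
    qed (simp add: f_def)
    also have "\<dots> = integral {u..1} k"
      using borel_integrable_atLeastAtMost'[OF cont] by (rule set_borel_integral_eq_integral)
    finally show ?thesis .
  qed
  have snd: "(\<integral>u. f u q \<partial>M) = indicator {0..<1} q * (k q * F q)" for q
  proof (cases "q \<in> {0..<1}")
    case True
    have "(\<integral>u. f u q \<partial>M) = (\<integral>u. k' q * indicator {0..q} u \<partial>M)"
      by (rule Bochner_Integration.integral_cong) (auto simp: f_def space indicator_def)
    also have "\<dots> = k' q * measure M {0..q}"
      using True cdf by (subst integral_mult_right_zero) (auto simp: space intro!: arg_cong[where f="measure M"])
    also have "measure M {0..q} = F q"
      using True cdf F by (auto simp: measure_def)
    finally show ?thesis using True by (simp add: k'_def)
  qed (auto simp: f_def k'_def cong: if_cong)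
  have "integrable M (\<lambda>u. \<integral>q. f u q \<partial>lborel)"
    using P.integrable_fst'[OF int] by simp
  then show "integrable M (\<lambda>u. integral {u..1} k)"
    using fst by (subst (asm) Bochner_Integration.integrable_cong[OF refl]) auto
  have "integrable lborel (\<lambda>q. \<integral>u. f u q \<partial>M)"
    using P.integrable_snd[OF int] by simp
  then have "((\<lambda>q. indicator {0..<1} q * (k q * F q)) has_integral
      (\<integral>q. (\<integral>u. f u q \<partial>M) \<partial>lborel)) UNIV"
    unfolding snd by (rule has_integral_integral_lborel)
  also have "(\<integral>q. (\<integral>u. f u q \<partial>M) \<partial>lborel) = (\<integral>u. (\<integral>q. f u q \<partial>lborel) \<partial>M)"
    using P.Fubini_integral[OF int] .
  also have "\<dots> = (\<integral>u. integral {u..1} k \<partial>M)"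
    using fst by (rule Bochner_Integration.integral_cong[OF refl])
  finally have "((\<lambda>q. if q \<in> {0..1} then k q * F q else 0) has_integral (\<integral>u. integral {u..1} k \<partial>M)) UNIV"
    by (rule has_integral_spike[of "{1}", rotated 2]) (auto simp: indicator_def)
  then have "((\<lambda>q. k q * F q) has_integral (\<integral>u. integral {u..1} k \<partial>M)) {0..1}"
    by (simp only: has_integral_restrict_UNIV)
  then show "integral {0..1} (\<lambda>q. k q * F q) = (\<integral>u. integral {u..1} k \<partial>M)"
    by (rule integral_unique)
qed

section \<open>Integrals of a continuous function against a member of \<open>inN\<close>\<close>

context
  fixes \<alpha> k :: "real \<Rightarrow> real"
  assumes N: "inN \<alpha>" and int: "\<alpha> integrable_on {0..1}" and k: "continuous_on {0..1} k"
begin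

text \<open>\<alpha> may be unbounded near 1. Being nonnegative off the point 1, it is absolutely
  integrable, and a bounded measurable factor preserves this.\<close>

lemma continuous_mult_inN_integrable: "(\<lambda>u. k u * \<alpha> u) integrable_on {0..1}"
proof -
  have "(\<lambda>s. if s = 1 then 0 else \<alpha> s) absolutely_integrable_on {0..1}"
    using inN_nonneg[OF N int]
    by (intro nonnegative_absolutely_integrable_1 integrable_spike[OF int, of "{1}"]) auto
  then have "\<alpha> absolutely_integrable_on {0..1}"
    by (rule absolutely_integrable_spike[of _ _ "{1}"]) auto
  then have "(\<lambda>u. k u * \<alpha> u) absolutely_integrable_on {0..1}"
    using k by (intro absolutely_integrable_bounded_measurable_product_real
      continuous_imp_measurable_on_sets_lebesgue compact_imp_bounded compact_continuous_image) auto
  then show ?thesis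
    by (rule set_lebesgue_integral_eq_integral(1))
qed

lemma continuous_on_tail_integral: "continuous_on {0..1} (\<lambda>u. integral {u..1} k)"
proof -
  have ki: "k integrable_on {0..1}" using k by (rule integrable_continuous_real)
  have eq: "integral {0..1} k - integral {0..u} k = integral {u..1} k" if "u \<in> {0..1}" for u
    using Henstock_Kurzweil_Integration.integral_combine[of 0 u 1 k] that ki by simp
  have "continuous_on {0..1} (\<lambda>u. integral {0..1} k - integral {0..u} k)"
    by (intro continuous_intros indefinite_integral_continuous_1[OF ki])
  then show ?thesis by (rule continuous_on_eq) (rule eq)
qed

text \<open>No boundary terms appear: the primitive of \<alpha> vanishes at 0 and the tail integral
  of \<open>k\<close> vanishes at 1. The proof applies the Fubini lemma to the measure
  \<open>M\<close> with density \<alpha>, whose distribution function is that primitive.\<close>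

lemma integral_by_parts_inN:
  shows "integral {0..1} (\<lambda>q. k q * integral {0..q} \<alpha>) = integral {0..1} (\<lambda>u. integral {u..1} k * \<alpha> u)"
proof -
  let ?A = "\<lambda>q. integral {0..q} \<alpha>"
  let ?a = "\<lambda>s. indicator {0..<1} s * \<alpha> s"
  let ?G = "\<lambda>u. integral {u..1} k"
  have [measurable]: "?a \<in> borel_measurable borel"
    by (rule inN_borel_measurable[OF N int])
  have a0: "AE s in lborel. 0 \<le> ?a s"
    using inN_nonneg[OF N int] by (auto simp: indicator_def)
  have prod: "(\<lambda>u. ?a u *\<^sub>R (indicator {0..<1} u *\<^sub>R ?G u)) = (\<lambda>u. indicator {0..<1} u * (?G u * \<alpha> u))"
    by (auto simp: fun_eq_iff indicator_def)
  define M where "M = restrict_space (density lborel ?a) {0..<1}"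
  have bm: "(\<lambda>q. indicator {0..<1} q * f q) \<in> borel_measurable borel"
    if "continuous_on {0..1} f" for f :: "real \<Rightarrow> real"
  proof -
    have "continuous_on {0..<1} f" by (rule continuous_on_subset[OF that]) auto
    then show ?thesis using borel_measurable_continuous_on_indicator[of "{0..<1}" f] by simp
  qed
  have cdf: "emeasure M {0..q} = ennreal (?A q)" if q: "0 \<le> q" "q < 1" for q
  proof -
    have "emeasure M {0..q} = emeasure (density lborel ?a) {0..q}"
      unfolding M_def using q by (intro emeasure_restrict_space) auto
    also have "\<dots> = (\<integral>\<^sup>+s. ennreal (?a s) * indicator {0..q} s \<partial>lborel)"
      by (rule emeasure_density) auto
    also have "\<dots> = (\<integral>\<^sup>+s. ennreal (indicator {0..<q} s * \<alpha> s) \<partial>lborel)"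
    proof (rule nn_integral_cong_AE)
      have "AE s in lborel. s \<noteq> q" using AE_lborel_singleton[of q] by auto
      then show "AE s in lborel. ennreal (?a s) * indicator {0..q} s = ennreal (indicator {0..<q} s * \<alpha> s)"
        by eventually_elim (use q in \<open>auto simp: indicator_def\<close>)
    qed
    finally show ?thesis using inN_nn_integral[OF N int, of q] q by simp
  qed
  have fin: "(\<integral>\<^sup>+q. ennreal (indicator {0..<1} q * ?A q) \<partial>lborel) < \<infinity>"
  proof -
    have "(\<integral>\<^sup>+q. ennreal (indicator {0..<1} q * ?A q) \<partial>lborel)
        \<le> (\<integral>\<^sup>+q. ennreal (?A 1) * indicator {0..<1::real} q \<partial>lborel)"
      by (intro nn_integral_mono) (auto simp: indicator_def intro!: ennreal_leI inN_integral_mono[OF N int])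
    also have "\<dots> < \<infinity>" by (subst nn_integral_cmult_indicator) auto
    finally show ?thesis .
  qed
  have sets: "sets M = sets (restrict_space borel {0..<1})"
    by (simp add: M_def sets_restrict_space)
  have "integral {0..1} (\<lambda>q. k q * ?A q) = (\<integral>u. ?G u \<partial>M)"
    using inN_integral_nonneg[OF N int] bm[OF inN_continuous_integral[OF N int]]
    by (intro integral_against_distribution_function[OF sets cdf _ _ fin k]) auto
  also have "\<dots> = (\<integral>u. indicator {0..<1} u *\<^sub>R ?G u \<partial>density lborel ?a)"
    unfolding M_def by (rule integral_restrict_space) auto
  also have "\<dots> = (\<integral>u. ?a u *\<^sub>R (indicator {0..<1} u *\<^sub>R ?G u) \<partial>lborel)"
    using bm[OF continuous_on_tail_integral] a0 by (intro integral_density) simp_all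
  finally have eq: "integral {0..1} (\<lambda>q. k q * ?A q) = (\<integral>u. indicator {0..<1} u * (?G u * \<alpha> u) \<partial>lborel)"
    unfolding prod .
  have "integrable M ?G"
    using inN_integral_nonneg[OF N int] bm[OF inN_continuous_integral[OF N int]]
    by (intro integral_against_distribution_function[OF sets cdf _ _ fin k]) auto
  then have "integrable (density lborel ?a) (\<lambda>u. indicator {0..<1} u *\<^sub>R ?G u)"
    unfolding M_def by (subst (asm) integrable_restrict_space) auto
  then have "integrable lborel (\<lambda>u. ?a u *\<^sub>R (indicator {0..<1} u *\<^sub>R ?G u))"
    using bm[OF continuous_on_tail_integral] a0 by (subst (asm) integrable_density) simp_all
  then have "((\<lambda>u. indicator {0..<1} u * (?G u * \<alpha> u)) has_integral
      integral {0..1} (\<lambda>q. k q * ?A q)) UNIV"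
    unfolding eq prod by (rule has_integral_integral_lborel)
  then have "((\<lambda>u. if u \<in> {0..1} then ?G u * \<alpha> u else 0) has_integral
      integral {0..1} (\<lambda>q. k q * ?A q)) UNIV"
    by (rule has_integral_spike[of "{1}", rotated 2]) (auto simp: indicator_def)
  then show ?thesis
    by (simp only: has_integral_restrict_UNIV integral_unique)
qed

text \<open>The second mean value theorem is applied on \<open>{0..t}\<close> with t < 1, because
  \<alpha> may blow up at 1; the boundary term at t disappears in the limit since \<alpha> is
  integrable.\<close>

lemma integral_mult_inN_nonneg:
  assumes G: "\<And>u. 0 \<le> u \<Longrightarrow> u \<le> 1 \<Longrightarrow> 0 \<le> integral {u..1} k"
  shows "0 \<le> integral {0..1} (\<lambda>u. k u * \<alpha> u)"
proof -
  let ?A = "\<lambda>q. integral {0..q} \<alpha>"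
  have ki: "k integrable_on {a..b}" if "0 \<le> a" "b \<le> 1" for a b
    using continuous_on_subset[OF k] that by (intro integrable_continuous_real) auto
  obtain C where C0: "0 \<le> C" and C: "\<And>q. 0 \<le> q \<Longrightarrow> q \<le> 1 \<Longrightarrow> \<bar>k q\<bar> \<le> C"
    using continuous_on_unit_interval_bound[OF k] by blast
  \<comment> \<open>\<open>H 1\<close> is the integral in question. The correction vanishes at 1 and
    absorbs the boundary term \<open>\<alpha> t * integral {t..1} k\<close>.\<close>
  define H where "H t = integral {0..t} (\<lambda>u. k u * \<alpha> u) + C * (?A 1 - ?A t)" for t
  have "continuous_on {0..1} H"
    unfolding H_def by (intro continuous_intros indefinite_integral_continuous_1 
      continuous_mult_inN_integrable int)
  then have lim: "(H \<longlongrightarrow> H 1) (at_left 1)"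
    by (auto simp: continuous_on_Icc_at_leftD)
  have "0 \<le> H t" if t: "0 \<le> t" "t < 1" for t
  proof -
    have comb: "integral {a..1} k = integral {a..b} k + integral {b..1} k"
      if "0 \<le> a" "a \<le> b" "b \<le> 1" for a b
      using Henstock_Kurzweil_Integration.integral_combine[of a b 1 k] that ki by simp
    obtain c where c: "c \<in> {0..t}" and
      I: "integral {0..t} (\<lambda>x. \<alpha> x * k x) = \<alpha> 0 * integral {0..c} k + \<alpha> t * integral {c..t} k"
      using second_mean_value_theorem[of k 0 t \<alpha>] ki inN_mono[OF N int] t by auto
    \<comment> \<open>Rewritten through tails from 0, \<open>c\<close> and \<open>t\<close>. The
      first two enter with the nonnegative weights \<open>\<alpha> 0\<close> and
      \<open>\<alpha> t - \<alpha> 0\<close>, so only the tail at \<open>t\<close> can be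
      harmful.\<close>
    have "integral {0..t} (\<lambda>x. \<alpha> x * k x) = \<alpha> 0 * integral {0..1} k
        + (\<alpha> t - \<alpha> 0) * integral {c..1} k - \<alpha> t * integral {t..1} k"
      using I comb[of 0 c] comb[of c t] c t by (simp add: algebra_simps)
    also have "\<dots> \<ge> - (\<alpha> t * integral {t..1} k)"
      using G[of 0] G[of c] c t inN_mono[OF N int, of 0 t] inN_nonneg[OF N int, of 0] by simp
    finally have 1: "- (\<alpha> t * integral {t..1} k) \<le> integral {0..t} (\<lambda>u. k u * \<alpha> u)"
      by (simp add: mult.commute)
    \<comment> \<open>That tail is at most \<open>C * (1 - t)\<close>, and by monotonicity
      \<open>\<alpha> t * (1 - t)\<close> is at most the integral of \<alpha> over
      \<open>{t..1}\<close>.\<close>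
    have "norm (integral {t..1} k) \<le> C * (1 - t)"
      using t C by (intro integral_bound continuous_on_subset[OF k]) auto
    then have "\<alpha> t * integral {t..1} k \<le> \<alpha> t * (C * (1 - t))"
      using inN_nonneg[OF N int, of t] t by (intro mult_left_mono) auto
    also have "\<dots> = C * (\<alpha> t * (1 - t))" by simp
    also have "\<dots> \<le> C * (?A 1 - ?A t)"
      using inN_integral_diff_ge[OF N int, of t 1] t C0 by (intro mult_left_mono) auto
    finally show ?thesis using 1 by (simp add: H_def)
  qed
  then have ev: "\<forall>\<^sub>F t in at_left 1. 0 \<le> H t"
    by (intro eventually_mono[OF eventually_at_left_real[of 0 1]]) auto
  have "0 \<le> H 1"
    using lim ev by (rule tendsto_lowerbound) simp
  then show ?thesis by (simp add: H_def)
qed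

end

section \<open>First variation\<close>

lemma inK_convex:
  assumes K: "inK L \<alpha>" and K': "inK L' \<alpha>'" and t: "0 \<le> t" "t \<le> 1"
  shows "inK ((1 - t) * L + t * L') (\<lambda>s. (1 - t) * \<alpha> s + t * \<alpha>' s)"
proof -
  have int: "\<alpha> integrable_on {0..1}" "\<alpha>' integrable_on {0..1}"
    using K K' by (auto simp: inK_def)
  have "integral {0..1} (\<lambda>s. (1 - t) * \<alpha> s + t * \<alpha>' s)
      = (1 - t) * integral {0..1} \<alpha> + t * integral {0..1} \<alpha>'"
    using int by (simp add: Henstock_Kurzweil_Integration.integral_add integrable_on_mult_right)
  moreover have "(1 - t) * x + t * x' < (1 - t) * y + t * y'" if "x < y" "x' < y'" for x x' y y'
  proof (cases "t = 0")
    case False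
    then show ?thesis using that t by (intro add_le_less_mono mult_left_mono mult_strict_left_mono) auto
  qed (use that in auto)
  moreover from this[of 0 L 0 L'] have "0 < (1 - t) * L + t * L'"
    using K K' by (simp add: inK_def)
  moreover have "inN (\<lambda>s. (1 - t) * \<alpha> s + t * \<alpha>' s)"
    using K K' t unfolding inK_def inN_def mono_on_def
    by (auto intro!: add_mono mult_left_mono add_nonneg_nonneg mult_nonneg_nonneg continuous_intros)
  ultimately show ?thesis
    using K K' int by (auto simp: inK_def intro!: integrable_add integrable_on_mult_right)
qed

section \<open>Bounds on the gap \<open>L - integral {0..q} \<alpha>\<close>, which is smallest at
  \<open>q = 1\<close>\<close>

context
  fixes L :: real and \<alpha> :: "real \<Rightarrow> real"
  assumes K: "inK L \<alpha>"
begin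

lemma inK_continuous: "continuous_on {0..1} (\<lambda>q. integral {0..q} \<alpha>)"
  using K by (intro inN_continuous_integral) (auto simp: inK_def)

lemma inK_gap_ge:
  assumes "0 \<le> q" "q \<le> 1"
  shows "L - integral {0..1} \<alpha> \<le> L - integral {0..q} \<alpha>"
  using inN_integral_mono[of \<alpha> q 1] K assms by (auto simp: inK_def)

lemma inK_gap_le:
  assumes "0 \<le> q" "q \<le> 1"
  shows "L - integral {0..q} \<alpha> \<le> L"
  using inN_integral_nonneg[of \<alpha> q] K assms by (auto simp: inK_def)

lemma inK_gap_1_pos: "0 < L - integral {0..1} \<alpha>"
  using K by (simp add: inK_def)

lemma inK_gap_pos: "0 \<le> q \<Longrightarrow> q \<le> 1 \<Longrightarrow> 0 < L - integral {0..q} \<alpha>"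
  using inK_gap_ge[of q] inK_gap_1_pos by linarith

end

locale mixed_p_spin =
  fixes \<gamma> :: "nat \<Rightarrow> real" and h :: real
  assumes summ: "summable (\<lambda>p. 2 ^ p * (\<gamma> p)\<^sup>2)"
begin

lemma DERIV_deriv_xi:
  "\<bar>x\<bar> < 2 \<Longrightarrow> (deriv (xi \<gamma>) has_real_derivative deriv (deriv (xi \<gamma>)) x) (at x)"
  using xi_three_derivatives[OF summ] by metis

lemma continuous_on_deriv2_xi: "continuous_on {0..1} (deriv (deriv (xi \<gamma>)))"
proof -
  obtain X where X: "\<And>x. \<bar>x\<bar> < 2 \<Longrightarrow> (deriv (deriv (xi \<gamma>)) has_real_derivative X x) (at x)"
    using xi_three_derivatives[OF summ] by metis
  show ?thesis
    by (intro continuous_at_imp_continuous_on ballI DERIV_isCont[OF X]) auto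
qed

text \<open>The third derivative is bounded on \<open>{0..1}\<close>. The bound later controls
  \<alpha> when the zeros of \<open>gfun\<close> accumulate at 1.\<close>

lemma deriv2_xi_Lipschitz:
  obtains C where "0 \<le> C" "\<And>x y. 0 \<le> x \<Longrightarrow> x < y \<Longrightarrow> y \<le> 1 \<Longrightarrow>
    deriv (deriv (xi \<gamma>)) y - deriv (deriv (xi \<gamma>)) x \<le> C * (y - x)"
proof -
  obtain X where X: "\<And>x. \<bar>x\<bar> < 2 \<Longrightarrow> (deriv (deriv (xi \<gamma>)) has_real_derivative X x) (at x)"
    and Xc: "\<And>x. \<bar>x\<bar> < 2 \<Longrightarrow> isCont X x"
    using xi_three_derivatives[OF summ] by metis
  have "continuous_on {0..1} X"
    using Xc by (intro continuous_at_imp_continuous_on ballI) auto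
  then obtain C where C: "0 \<le> C" "\<And>q. 0 \<le> q \<Longrightarrow> q \<le> 1 \<Longrightarrow> \<bar>X q\<bar> \<le> C"
    using continuous_on_unit_interval_bound by blast
  show ?thesis
  proof
    fix x y :: real assume xy: "0 \<le> x" "x < y" "y \<le> 1"
    obtain z where z: "x < z" "z < y"
      "deriv (deriv (xi \<gamma>)) y - deriv (deriv (xi \<gamma>)) x = (y - x) * X z"
      using MVT2[OF xy(2), of "deriv (deriv (xi \<gamma>))" X] X xy by auto
    have "X z \<le> C" using C(2)[of z] z xy by auto
    then show "deriv (deriv (xi \<gamma>)) y - deriv (deriv (xi \<gamma>)) x \<le> C * (y - x)"
      using z(3) xy by (simp add: mult.commute)
  qed (rule C)
qed

text \<open>Twice the derivative of \<open>Qfun \<gamma> h\<close> at \<open>(L, \<alpha>)\<close> in the direction \<open>(L' - L, \<alpha>' - \<alpha>)\<close>.\<close>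

definition Qdir :: "real \<Rightarrow> (real \<Rightarrow> real) \<Rightarrow> real \<Rightarrow> (real \<Rightarrow> real) \<Rightarrow> real" where
  "Qdir L \<alpha> L' \<alpha>' = (deriv (xi \<gamma>) 1 + h\<^sup>2) * (L' - L)
     - integral {0..1} (\<lambda>q. deriv (deriv (xi \<gamma>)) q * (integral {0..q} \<alpha>' - integral {0..q} \<alpha>))
     - integral {0..1} (\<lambda>q. ((L' - integral {0..q} \<alpha>') - (L - integral {0..q} \<alpha>))
         / (L - integral {0..q} \<alpha>)\<^sup>2)"

text \<open>Exact expansion from 1/y - 1/x = -(y - x)/x^2 + (y - x)^2/(x^2 y), with x and y the two
  gaps; the other terms of \<open>Qfun\<close> are linear. The nonnegative remainder expresses
  convexity.\<close>

lemma Qfun_diff: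
  assumes K: "inK L \<alpha>" and K': "inK L' \<alpha>'"
  shows "2 * (Qfun \<gamma> h L' \<alpha>' - Qfun \<gamma> h L \<alpha>) = Qdir L \<alpha> L' \<alpha>'
    + integral {0..1} (\<lambda>q. ((L' - integral {0..q} \<alpha>') - (L - integral {0..q} \<alpha>))\<^sup>2
         / ((L - integral {0..q} \<alpha>)\<^sup>2 * (L' - integral {0..q} \<alpha>')))"
proof -
  define A where "A q = integral {0..q} \<alpha>" for q
  define A' where "A' q = integral {0..q} \<alpha>'" for q
  let ?f = "deriv (deriv (xi \<gamma>))"
  have c: "continuous_on {0..1} A" "continuous_on {0..1} A'"
    using inK_continuous[OF K] inK_continuous[OF K'] by (auto simp: A_def[abs_def] A'_def[abs_def])
  have p: "0 < L - A q" "0 < L' - A' q" if "q \<in> {0..1}" for q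
    using inK_gap_pos[OF K] inK_gap_pos[OF K'] that by (auto simp: A_def A'_def)
  then have ne: "L - A q \<noteq> 0" "L' - A' q \<noteq> 0" if "q \<in> {0..1}" for q
    using that by (metis less_irrefl)+
  note ci = integrable_continuous_real continuous_intros c continuous_on_deriv2_xi
  have "integral {0..1} (\<lambda>q. ?f q * (A' q - A q)) = integral {0..1} (\<lambda>q. ?f q * A' q - ?f q * A q)"
    by (simp add: right_diff_distrib)
  also have "\<dots> = integral {0..1} (\<lambda>q. ?f q * A' q) - integral {0..1} (\<lambda>q. ?f q * A q)"
    by (intro Henstock_Kurzweil_Integration.integral_diff ci)
  finally have 1: "integral {0..1} (\<lambda>q. ?f q * (A' q - A q)) =
    integral {0..1} (\<lambda>q. ?f q * A' q) - integral {0..1} (\<lambda>q. ?f q * A q)" .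
  have "integral {0..1} (\<lambda>q. ((L' - A' q) - (L - A q))\<^sup>2 / ((L - A q)\<^sup>2 * (L' - A' q)))
    = integral {0..1} (\<lambda>q. (1 / (L' - A' q) - 1 / (L - A q)) + ((L' - A' q) - (L - A q)) / (L - A q)\<^sup>2)"
  proof (rule Henstock_Kurzweil_Integration.integral_cong)
    fix q :: real assume "q \<in> {0..1}"
    then have "L - A q \<noteq> 0" "L' - A' q \<noteq> 0" using ne by auto
    then show "((L' - A' q) - (L - A q))\<^sup>2 / ((L - A q)\<^sup>2 * (L' - A' q))
        = (1 / (L' - A' q) - 1 / (L - A q)) + ((L' - A' q) - (L - A q)) / (L - A q)\<^sup>2"
      by (simp add: divide_simps) (simp add: algebra_simps power2_eq_square)
  qed
  also have "\<dots> = integral {0..1} (\<lambda>q. 1 / (L' - A' q)) - integral {0..1} (\<lambda>q. 1 / (L - A q))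
      + integral {0..1} (\<lambda>q. ((L' - A' q) - (L - A q)) / (L - A q)\<^sup>2)"
    using ne by (subst Henstock_Kurzweil_Integration.integral_add
      Henstock_Kurzweil_Integration.integral_diff; (intro ci Henstock_Kurzweil_Integration.integrable_diff)?; auto)+
  finally show ?thesis
    using 1 unfolding Qfun_def Qdir_def A_def A'_def by (simp add: algebra_simps)
qed

text \<open>Along the segment towards \<open>(L', \<alpha>')\<close> the gap is affine and the
  displacement is \<open>t\<close> times the full one, while \<open>Qdir\<close> is linear in the
  displacement.\<close>

lemma Qdir_segment:
  assumes K: "inK L \<alpha>" and K': "inK L' \<alpha>'" and t: "0 < t" "t \<le> 1"
  shows "Qdir L \<alpha> ((1 - t) * L + t * L') (\<lambda>s. (1 - t) * \<alpha> s + t * \<alpha>' s) = t * Qdir L \<alpha> L' \<alpha>'"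
    and "q \<in> {0..1} \<Longrightarrow> (1 - t) * L + t * L' - integral {0..q} (\<lambda>s. (1 - t) * \<alpha> s + t * \<alpha>' s)
      = (1 - t) * (L - integral {0..q} \<alpha>) + t * (L' - integral {0..q} \<alpha>')"
proof -
  have A: "integral {0..q} (\<lambda>s. (1 - t) * \<alpha> s + t * \<alpha>' s)
      = (1 - t) * integral {0..q} \<alpha> + t * integral {0..q} \<alpha>'" if "q \<in> {0..1}" for q
  proof -
    have "\<alpha> integrable_on {0..q}" "\<alpha>' integrable_on {0..q}"
      using that K K' by (auto simp: inK_def intro: inN_integrable_on)
    then show ?thesis
      by (simp add: Henstock_Kurzweil_Integration.integral_add integrable_on_mult_right)
  qed
  then show "(1 - t) * L + t * L' - integral {0..q} (\<lambda>s. (1 - t) * \<alpha> s + t * \<alpha>' s)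
      = (1 - t) * (L - integral {0..q} \<alpha>) + t * (L' - integral {0..q} \<alpha>')" if "q \<in> {0..1}"
    using that by (simp add: algebra_simps)
  have e1: "integral {0..1} (\<lambda>q. deriv (deriv (xi \<gamma>)) q *
      (integral {0..q} (\<lambda>s. (1 - t) * \<alpha> s + t * \<alpha>' s) - integral {0..q} \<alpha>))
    = integral {0..1} (\<lambda>q. t * (deriv (deriv (xi \<gamma>)) q * (integral {0..q} \<alpha>' - integral {0..q} \<alpha>)))"
    by (rule Henstock_Kurzweil_Integration.integral_cong) (simp only: A, simp add: algebra_simps)
  have e2: "integral {0..1} (\<lambda>q. ((1 - t) * L + t * L' - integral {0..q} (\<lambda>s. (1 - t) * \<alpha> s + t * \<alpha>' s)
      - (L - integral {0..q} \<alpha>)) / (L - integral {0..q} \<alpha>)\<^sup>2)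
    = integral {0..1} (\<lambda>q. t * (((L' - integral {0..q} \<alpha>') - (L - integral {0..q} \<alpha>))
         / (L - integral {0..q} \<alpha>)\<^sup>2))"
    by (rule Henstock_Kurzweil_Integration.integral_cong) (simp only: A, simp add: algebra_simps)
  show "Qdir L \<alpha> ((1 - t) * L + t * L') (\<lambda>s. (1 - t) * \<alpha> s + t * \<alpha>' s) = t * Qdir L \<alpha> L' \<alpha>'"
    unfolding Qdir_def e1 e2 integral_mult_right by (simp add: algebra_simps)
qed

text \<open>One direction drops the nonnegative remainder of \<open>Qfun_diff\<close>. The other
  moves a fraction \<open>t\<close> along a segment, where the remainder is of order
  \<open>t\<^sup>2\<close>, divides by \<open>t\<close> and lets \<open>t\<close> tend to 0.\<close>

lemma is_minimizer_iff_Qdir_nonneg: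
  assumes K: "inK L \<alpha>"
  shows "is_minimizer \<gamma> h L \<alpha> \<longleftrightarrow> (\<forall>L' \<alpha>'. inK L' \<alpha>' \<longrightarrow> 0 \<le> Qdir L \<alpha> L' \<alpha>')"
proof (intro iffI allI impI)
  assume *: "\<forall>L' \<alpha>'. inK L' \<alpha>' \<longrightarrow> 0 \<le> Qdir L \<alpha> L' \<alpha>'"
  have "Qfun \<gamma> h L \<alpha> \<le> Qfun \<gamma> h L' \<alpha>'" if K': "inK L' \<alpha>'" for L' \<alpha>'
  proof -
    let ?r = "\<lambda>q. ((L' - integral {0..q} \<alpha>') - (L - integral {0..q} \<alpha>))\<^sup>2
         / ((L - integral {0..q} \<alpha>)\<^sup>2 * (L' - integral {0..q} \<alpha>'))"
    have "0 \<le> ?r q" if "q \<in> {0..1}" for q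
      using inK_gap_pos[OF K', of q] that by (intro divide_nonneg_nonneg mult_nonneg_nonneg) auto
    \<comment> \<open>In the non-integrable case the integral takes its default value 0.\<close>
    then have "0 \<le> integral {0..1} ?r"
      using Henstock_Kurzweil_Integration.integral_nonneg[of ?r "{0..1}"]
      by (cases "?r integrable_on {0..1}") (auto simp: not_integrable_integral)
    then show ?thesis
      using Qfun_diff[OF K K'] * K' by fastforce
  qed
  then show "is_minimizer \<gamma> h L \<alpha>"
    using K by (auto simp: is_minimizer_def)
next
  fix L' \<alpha>' assume min: "is_minimizer \<gamma> h L \<alpha>" and K': "inK L' \<alpha>'"
  define B where "B q = L - integral {0..q} \<alpha>" for q
  define B' where "B' q = L' - integral {0..q} \<alpha>'" for q
  \<comment> \<open>A positive lower bound for both gaps, hence for every gap on the segment; the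
    remainder's denominator is then at least \<open>m ^ 3\<close>, which yields the constant
    \<open>C\<close> independent of \<open>t\<close>.\<close>
  define m where "m = min (B 1) (B' 1)"
  have m: "0 < m" "m \<le> B q" "m \<le> B' q" if "q \<in> {0..1}" for q
    using inK_gap_1_pos[OF K] inK_gap_1_pos[OF K'] inK_gap_ge[OF K, of q] inK_gap_ge[OF K', of q] that
    by (auto simp: m_def B_def B'_def)
  have c: "continuous_on {0..1} B" "continuous_on {0..1} B'"
    using inK_continuous[OF K] inK_continuous[OF K']
    by (auto simp: B_def[abs_def] B'_def[abs_def] intro!: continuous_intros)
  define C where "C = integral {0..1} (\<lambda>q. (B' q - B q)\<^sup>2 / m ^ 3)"
  have "0 \<le> Qdir L \<alpha> L' \<alpha>' + t * C" if t: "0 < t" "t \<le> 1" for t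
  proof -
    let ?L = "(1 - t) * L + t * L'" and ?a = "\<lambda>s. (1 - t) * \<alpha> s + t * \<alpha>' s"
    let ?B = "\<lambda>q. (1 - t) * B q + t * B' q"
    have Kt: "inK ?L ?a" using inK_convex[OF K K'] t by auto
    have eq: "?L - integral {0..q} ?a = ?B q" if "q \<in> {0..1}" for q
      using Qdir_segment(2)[OF K K' t that] by (simp add: B_def B'_def)
    have mt: "m \<le> ?B q" if "q \<in> {0..1}" for q
    proof -
      have "(1 - t) * m + t * m \<le> ?B q"
        using m[OF that] t by (intro add_mono mult_left_mono) auto
      then show ?thesis by (simp add: algebra_simps)
    qed
    have "integral {0..1} (\<lambda>q. ((?L - integral {0..q} ?a) - B q)\<^sup>2 / ((B q)\<^sup>2 * (?L - integral {0..q} ?a)))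
      = integral {0..1} (\<lambda>q. (?B q - B q)\<^sup>2 / ((B q)\<^sup>2 * ?B q))"
      by (rule Henstock_Kurzweil_Integration.integral_cong) (simp only: eq)
    also have "\<dots> \<le> integral {0..1} (\<lambda>q. t\<^sup>2 * ((B' q - B q)\<^sup>2 / m ^ 3))"
    proof (rule integral_le)
      have "(B q)\<^sup>2 * ?B q \<noteq> 0" if "q \<in> {0..1}" for q
        using m[OF that] mt[OF that] by auto
      then show "(\<lambda>q. (?B q - B q)\<^sup>2 / ((B q)\<^sup>2 * ?B q)) integrable_on {0..1}"
        by (intro integrable_continuous_real continuous_intros c) auto
      show "(\<lambda>q. t\<^sup>2 * ((B' q - B q)\<^sup>2 / m ^ 3)) integrable_on {0..1}"
        using m[of 0] by (intro integrable_continuous_real continuous_intros c) auto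
      fix q :: real assume q: "q \<in> {0..1}"
      have "m ^ 3 = m\<^sup>2 * m" by (simp add: power2_eq_square power3_eq_cube)
      also have "\<dots> \<le> (B q)\<^sup>2 * ?B q"
        using m[OF q] mt[OF q] by (intro mult_mono power_mono) auto
      finally have "(?B q - B q)\<^sup>2 / ((B q)\<^sup>2 * ?B q) \<le> (?B q - B q)\<^sup>2 / m ^ 3"
        using m[OF q] mt[OF q] by (intro divide_left_mono mult_pos_pos) auto
      moreover have "(?B q - B q)\<^sup>2 = t\<^sup>2 * (B' q - B q)\<^sup>2"
        by (simp add: algebra_simps power2_eq_square)
      ultimately show "(?B q - B q)\<^sup>2 / ((B q)\<^sup>2 * ?B q) \<le> t\<^sup>2 * ((B' q - B q)\<^sup>2 / m ^ 3)"
        by simp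
    qed
    also have "\<dots> = t\<^sup>2 * C" by (simp add: C_def)
    finally have "2 * (Qfun \<gamma> h ?L ?a - Qfun \<gamma> h L \<alpha>) \<le> t * Qdir L \<alpha> L' \<alpha>' + t\<^sup>2 * C"
      unfolding Qfun_diff[OF K Kt] Qdir_segment(1)[OF K K' t] B_def by simp
    moreover have "Qfun \<gamma> h L \<alpha> \<le> Qfun \<gamma> h ?L ?a"
      using min Kt by (auto simp: is_minimizer_def)
    ultimately have "0 \<le> t * (Qdir L \<alpha> L' \<alpha>' + t * C)"
      by (simp add: algebra_simps power2_eq_square)
    then show ?thesis using t by (simp add: zero_le_mult_iff)
  qed
  then have ev: "\<forall>\<^sub>F t in at_right 0. 0 \<le> Qdir L \<alpha> L' \<alpha>' + t * C"
    by (intro eventually_mono[OF eventually_at_right_real[of 0 1]]) auto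
  have "((\<lambda>t. Qdir L \<alpha> L' \<alpha>' + t * C) \<longlongrightarrow> Qdir L \<alpha> L' \<alpha>' + 0 * C) (at_right 0)"
    by (intro tendsto_intros)
  then show "0 \<le> Qdir L \<alpha> L' \<alpha>'"
    using tendsto_lowerbound[OF _ ev] by simp
qed

section \<open>Optimality conditions\<close>

context
  fixes L :: real and \<alpha> :: "real \<Rightarrow> real"
  assumes K: "inK L \<alpha>"
begin

lemma continuous_on_inverse_gap_square:
  "continuous_on {0..1} (\<lambda>q. 1 / (L - integral {0..q} \<alpha>)\<^sup>2)"
proof -
  have "(L - integral {0..q} \<alpha>)\<^sup>2 \<noteq> 0" if "q \<in> {0..1}" for q
    using inK_gap_pos[OF K, of q] that by auto
  then show ?thesis
    by (intro continuous_intros inK_continuous[OF K]) auto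
qed

lemma DERIV_gbar:
  assumes "x \<in> {0..1}"
  shows "(gbar \<gamma> h L \<alpha> has_real_derivative
    deriv (deriv (xi \<gamma>)) x - 1 / (L - integral {0..x} \<alpha>)\<^sup>2) (at x within {0..1})"
proof -
  have "(deriv (xi \<gamma>) has_real_derivative deriv (deriv (xi \<gamma>)) x) (at x within {0..1})"
    using assms by (intro has_field_derivative_at_within[OF DERIV_deriv_xi]) auto
  moreover have "((\<lambda>s. integral {0..s} (\<lambda>q. 1 / (L - integral {0..q} \<alpha>)\<^sup>2)) has_real_derivative
      1 / (L - integral {0..x} \<alpha>)\<^sup>2) (at x within {0..1})"
    by (rule integral_has_real_derivative[OF continuous_on_inverse_gap_square assms])
  ultimately show ?thesis
    unfolding gbar_def[abs_def] by (auto intro!: derivative_eq_intros)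
qed

lemma continuous_on_gbar: "continuous_on {0..1} (gbar \<gamma> h L \<alpha>)"
  by (rule DERIV_continuous_on[OF DERIV_gbar])

lemma integral_deriv_gbar:
  assumes "u \<in> {0..1}"
  shows "integral {u..1} (\<lambda>q. deriv (deriv (xi \<gamma>)) q - 1 / (L - integral {0..q} \<alpha>)\<^sup>2)
    = gbar \<gamma> h L \<alpha> 1 - gbar \<gamma> h L \<alpha> u"
proof (rule integral_unique, rule fundamental_theorem_of_calculus)
  fix x assume x: "x \<in> {u..1}"
  then have "(gbar \<gamma> h L \<alpha> has_real_derivative
    deriv (deriv (xi \<gamma>)) x - 1 / (L - integral {0..x} \<alpha>)\<^sup>2) (at x within {u..1})"
    using assms by (intro has_field_derivative_subset[OF DERIV_gbar]) auto
  then show "(gbar \<gamma> h L \<alpha> has_vector_derivative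
    deriv (deriv (xi \<gamma>)) x - 1 / (L - integral {0..x} \<alpha>)\<^sup>2) (at x within {u..1})"
    by (simp add: has_real_derivative_iff_has_vector_derivative)
qed (use assms in auto)

text \<open>Integration by parts: the first factor is the derivative of \<open>gbar\<close>, so its
  tail integral from u is \<open>gbar\<close> at 1 minus \<open>gbar\<close> at u.\<close>

lemma integral_deriv_gbar_mult:
  assumes K': "inK L' \<alpha>'"
  shows "integral {0..1} (\<lambda>q. (deriv (deriv (xi \<gamma>)) q - 1 / (L - integral {0..q} \<alpha>)\<^sup>2)
      * integral {0..q} \<alpha>')
    = gbar \<gamma> h L \<alpha> 1 * integral {0..1} \<alpha>' - integral {0..1} (\<lambda>u. gbar \<gamma> h L \<alpha> u * \<alpha>' u)"
proof -
  let ?k = "\<lambda>q. deriv (deriv (xi \<gamma>)) q - 1 / (L - integral {0..q} \<alpha>)\<^sup>2"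
  have N': "inN \<alpha>'" "\<alpha>' integrable_on {0..1}" using K' by (auto simp: inK_def)
  have "continuous_on {0..1} ?k"
    by (intro continuous_intros continuous_on_inverse_gap_square continuous_on_deriv2_xi)
  then have "integral {0..1} (\<lambda>q. ?k q * integral {0..q} \<alpha>') = integral {0..1} (\<lambda>u. integral {u..1} ?k * \<alpha>' u)"
    by (rule integral_by_parts_inN[OF N'])
  also have "\<dots> = integral {0..1} (\<lambda>u. gbar \<gamma> h L \<alpha> 1 * \<alpha>' u - gbar \<gamma> h L \<alpha> u * \<alpha>' u)"
    by (rule Henstock_Kurzweil_Integration.integral_cong) (simp only: integral_deriv_gbar left_diff_distrib)
  also have "\<dots> = gbar \<gamma> h L \<alpha> 1 * integral {0..1} \<alpha>' - integral {0..1} (\<lambda>u. gbar \<gamma> h L \<alpha> u * \<alpha>' u)"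
    using continuous_mult_inN_integrable[OF N' continuous_on_gbar] N'
    by (subst Henstock_Kurzweil_Integration.integral_diff) (auto intro: integrable_on_mult_right)
  finally show ?thesis .
qed

lemma Qdir_eq:
  assumes K': "inK L' \<alpha>'"
  shows "Qdir L \<alpha> L' \<alpha>' =
    gbar \<gamma> h L \<alpha> 1 * ((L' - integral {0..1} \<alpha>') - (L - integral {0..1} \<alpha>))
    + integral {0..1} (\<lambda>u. gbar \<gamma> h L \<alpha> u * \<alpha>' u) - integral {0..1} (\<lambda>u. gbar \<gamma> h L \<alpha> u * \<alpha> u)"
proof -
  define A where "A q = integral {0..q} \<alpha>" for q
  define A' where "A' q = integral {0..q} \<alpha>'" for q
  define w where "w q = 1 / (L - integral {0..q} \<alpha>)\<^sup>2" for q
  let ?f = "deriv (deriv (xi \<gamma>))"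
  have c: "continuous_on {0..1} A" "continuous_on {0..1} A'" "continuous_on {0..1} w"
    using inK_continuous[OF K] inK_continuous[OF K'] continuous_on_inverse_gap_square
    by (auto simp: A_def[abs_def] A'_def[abs_def] w_def[abs_def])
  note ci = integrable_continuous_real continuous_intros c continuous_on_deriv2_xi
  have "integral {0..1} (\<lambda>q. ?f q * (A' q - A q)) + integral {0..1} (\<lambda>q. ((L' - A' q) - (L - A q)) * w q)
    = integral {0..1} (\<lambda>q. ?f q * (A' q - A q) + ((L' - A' q) - (L - A q)) * w q)"
    by (intro Henstock_Kurzweil_Integration.integral_add[symmetric] ci)
  \<comment> \<open>Regrouped so that \<open>L' - L\<close> is weighted by \<open>w\<close> and
    \<open>A' - A\<close> by \<open>?f - w\<close>, the derivative of \<open>gbar\<close>.\<close>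
  also have "\<dots> = integral {0..1} (\<lambda>q. (L' - L) * w q + ((?f q - w q) * A' q - (?f q - w q) * A q))"
    by (rule Henstock_Kurzweil_Integration.integral_cong) (simp add: algebra_simps)
  also have "\<dots> = integral {0..1} (\<lambda>q. (L' - L) * w q) + integral {0..1} (\<lambda>q. (?f q - w q) * A' q - (?f q - w q) * A q)"
    by (intro Henstock_Kurzweil_Integration.integral_add ci)
  also have "integral {0..1} (\<lambda>q. (?f q - w q) * A' q - (?f q - w q) * A q)
    = integral {0..1} (\<lambda>q. (?f q - w q) * A' q) - integral {0..1} (\<lambda>q. (?f q - w q) * A q)"
    by (intro Henstock_Kurzweil_Integration.integral_diff ci)
  finally have eq: "integral {0..1} (\<lambda>q. ?f q * (A' q - A q))
      + integral {0..1} (\<lambda>q. ((L' - A' q) - (L - A q)) * w q)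
    = (L' - L) * integral {0..1} w + (integral {0..1} (\<lambda>q. (?f q - w q) * A' q)
      - integral {0..1} (\<lambda>q. (?f q - w q) * A q))"
    by simp
  have gb: "gbar \<gamma> h L \<alpha> 1 = deriv (xi \<gamma>) 1 + h\<^sup>2 - integral {0..1} w"
    by (simp add: gbar_def w_def[abs_def])
  have "Qdir L \<alpha> L' \<alpha>' = (deriv (xi \<gamma>) 1 + h\<^sup>2) * (L' - L)
    - (integral {0..1} (\<lambda>q. ?f q * (A' q - A q))
      + integral {0..1} (\<lambda>q. ((L' - A' q) - (L - A q)) * w q))"
    by (simp add: Qdir_def A_def A'_def w_def)
  also have "\<dots> = gbar \<gamma> h L \<alpha> 1 * (L' - L) - (integral {0..1} (\<lambda>q. (?f q - w q) * A' q)
      - integral {0..1} (\<lambda>q. (?f q - w q) * A q))"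
    unfolding eq gb by (simp add: algebra_simps)
  also have "\<dots> = gbar \<gamma> h L \<alpha> 1 * (L' - L)
    - ((gbar \<gamma> h L \<alpha> 1 * integral {0..1} \<alpha>' - integral {0..1} (\<lambda>u. gbar \<gamma> h L \<alpha> u * \<alpha>' u))
      - (gbar \<gamma> h L \<alpha> 1 * integral {0..1} \<alpha> - integral {0..1} (\<lambda>u. gbar \<gamma> h L \<alpha> u * \<alpha> u)))"
    unfolding A_def A'_def w_def integral_deriv_gbar_mult[OF K] integral_deriv_gbar_mult[OF K'] ..
  finally show ?thesis by (simp add: right_diff_distrib)
qed

text \<open>The derivative of \<open>gfun\<close> is minus \<open>gbar\<close>, and an interior zero
  of a nonnegative function is a minimum. The proof uses the corresponding local maximum of the
  integral from 0.\<close>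

lemma gbar_zero_of_gfun_zero:
  assumes nonneg: "\<And>u. u \<in> {0..1} \<Longrightarrow> 0 \<le> gfun \<gamma> h L \<alpha> u"
    and u: "0 < u" "u < 1" "gfun \<gamma> h L \<alpha> u = 0"
  shows "gbar \<gamma> h L \<alpha> u = 0"
proof -
  let ?I = "\<lambda>v. integral {0..v} (gbar \<gamma> h L \<alpha>)"
  have gi: "gbar \<gamma> h L \<alpha> integrable_on {0..1}"
    using continuous_on_gbar by (rule integrable_continuous_real)
  have g: "gfun \<gamma> h L \<alpha> v = ?I 1 - ?I v" if "v \<in> {0..1}" for v
    using Henstock_Kurzweil_Integration.integral_combine[of 0 v 1 "gbar \<gamma> h L \<alpha>"] that gi
    by (simp add: gfun_def)
  have "(?I has_real_derivative gbar \<gamma> h L \<alpha> u) (at u within {0..1})"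
    using u by (intro integral_has_real_derivative[OF continuous_on_gbar]) auto
  then have "(?I has_real_derivative gbar \<gamma> h L \<alpha> u) (at u)"
    using u by (simp add: at_within_Icc_at)
  then show ?thesis
  proof (rule DERIV_local_max)
    show "0 < min u (1 - u)" using u by simp
    show "\<forall>v. \<bar>u - v\<bar> < min u (1 - u) \<longrightarrow> ?I v \<le> ?I u"
    proof (intro allI impI)
      fix v assume "\<bar>u - v\<bar> < min u (1 - u)"
      then have "v \<in> {0..1}" by auto
      then show "?I v \<le> ?I u"
        using nonneg[of v] g[of v] g[of u] u by auto
    qed
  qed
qed

text \<open>
  Near each zero \<open>u\<close> of \<open>gfun\<close> below \<open>1\<close>, Rolle's theorem for \<open>gbar\<close> on \<open>[u, 1]\<close> produces a point
  where \<open>\<xi>''\<close> equals the inverse square of the gap; between two such points the Lipschitz bound on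
  \<open>\<xi>''\<close> limits the growth of \<open>\<integral>\<alpha>\<close>.
\<close>

lemma inN_bounded_of_gfun_zeros_accumulate:
  assumes nonneg: "\<And>u. u \<in> {0..1} \<Longrightarrow> 0 \<le> gfun \<gamma> h L \<alpha> u"
    and one: "gbar \<gamma> h L \<alpha> 1 = 0"
    and acc: "\<And>t. 0 \<le> t \<Longrightarrow> t < 1 \<Longrightarrow> \<exists>u>t. u < 1 \<and> gfun \<gamma> h L \<alpha> u = 0"
  obtains M where "\<And>s. 0 \<le> s \<Longrightarrow> s < 1 \<Longrightarrow> \<alpha> s \<le> M"
proof -
  let ?f = "deriv (deriv (xi \<gamma>))"
  define B where "B q = L - integral {0..q} \<alpha>" for q
  have N: "inN \<alpha>" "\<alpha> integrable_on {0..1}" and L: "0 < L" using K by (auto simp: inK_def)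
  have Bm: "B 1 \<le> B q" "B q \<le> L" "0 < B q" if "0 \<le> q" "q \<le> 1" for q
    using inK_gap_ge[OF K that] inK_gap_le[OF K that] inK_gap_pos[OF K that] by (auto simp: B_def)
  obtain C where C: "0 \<le> C" "\<And>x y. 0 \<le> x \<Longrightarrow> x < y \<Longrightarrow> y \<le> 1 \<Longrightarrow> ?f y - ?f x \<le> C * (y - x)"
    using deriv2_xi_Lipschitz by blast
  have ex: "\<exists>v>t. v < 1 \<and> ?f v = 1 / (B v)\<^sup>2" if t: "0 \<le> t" "t < 1" for t
  proof -
    obtain u where u: "t < u" "u < 1" "gfun \<gamma> h L \<alpha> u = 0"
      using acc[OF t] by blast
    have u0: "gbar \<gamma> h L \<alpha> u = 0"
      using gbar_zero_of_gfun_zero[OF nonneg] u t by auto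
    have D: "(gbar \<gamma> h L \<alpha> has_real_derivative ?f x - 1 / (B x)\<^sup>2) (at x)" if "u < x" "x < 1" for x
      using DERIV_gbar[of x] that u t by (simp add: at_within_Icc_at B_def)
    have "\<exists>l z. u < z \<and> z < 1 \<and> DERIV (gbar \<gamma> h L \<alpha>) z :> l
        \<and> gbar \<gamma> h L \<alpha> 1 - gbar \<gamma> h L \<alpha> u = (1 - u) * l"
      using D u t
      by (intro MVT continuous_on_subset[OF continuous_on_gbar]) (auto simp: real_differentiable_def)
    then obtain l z where z: "u < z" "z < 1" "DERIV (gbar \<gamma> h L \<alpha>) z :> l"
      "gbar \<gamma> h L \<alpha> 1 - gbar \<gamma> h L \<alpha> u = (1 - u) * l"
      by blast
    have "l = ?f z - 1 / (B z)\<^sup>2"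
      using DERIV_unique[OF z(3) D] z by simp
    moreover have "l = 0" using z one u0 u by simp
    ultimately show ?thesis using z u by (intro exI[of _ z]) auto
  qed
  have "\<alpha> s \<le> C * L ^ 4 / (2 * B 1)" if s: "0 \<le> s" "s < 1" for s
  proof -
    obtain v where v: "s < v" "v < 1" "?f v = 1 / (B v)\<^sup>2" using ex[OF s] by blast
    obtain w where w: "v < w" "w < 1" "?f w = 1 / (B w)\<^sup>2" using ex[of v] v s by auto
    have Bv: "B 1 \<le> B v" "B v \<le> L" "0 < B v" and Bw: "B 1 \<le> B w" "B w \<le> L" "0 < B w"
      using Bm[of v] Bm[of w] s v w by auto
    have B1: "0 < B 1" using Bm[of 1] by simp
    have av: "0 \<le> \<alpha> v" using inN_nonneg[OF N, of v] s v by simp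
    have diff: "\<alpha> v * (w - v) \<le> B v - B w"
      using inN_integral_diff_ge[OF N, of v w] s v w by (simp add: B_def)
    have L4: "(B v)\<^sup>2 * (B w)\<^sup>2 \<le> L ^ 4"
    proof -
      have "(B v)\<^sup>2 * (B w)\<^sup>2 \<le> L\<^sup>2 * L\<^sup>2"
        using Bv Bw by (intro mult_mono power_mono) auto
      then show ?thesis by (simp flip: power_add)
    qed
    have "0 \<le> \<alpha> v * (w - v)" using av w by simp
    \<comment> \<open>The drop of \<open>(B q)\<^sup>2\<close> from \<open>v\<close> to
      \<open>w\<close> is compared from two sides: it is at least \<open>2 * B 1\<close> times the
      mass of \<alpha> between them, and it equals the increment of \<open>?f\<close> times
      \<open>(B v)\<^sup>2 * (B w)\<^sup>2\<close>. Cancelling \<open>w - v\<close> leaves the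
      bound.\<close>
    then have "\<alpha> v * (w - v) * (2 * B 1) \<le> (B v - B w) * (B v + B w)"
      using diff Bv Bw B1 by (intro mult_mono) auto
    also have "\<dots> = (?f w - ?f v) * ((B v)\<^sup>2 * (B w)\<^sup>2)"
      using Bv Bw by (simp add: v w field_simps power2_eq_square)
    also have "\<dots> \<le> (C * (w - v)) * L ^ 4"
      using C(2)[of v w] C(1) s v w L4 by (intro mult_mono) auto
    finally have "(w - v) * (\<alpha> v * (2 * B 1)) \<le> (w - v) * (C * L ^ 4)"
      by (simp add: algebra_simps)
    then have "\<alpha> v * (2 * B 1) \<le> C * L ^ 4"
      using w by simp
    then have "\<alpha> v \<le> C * L ^ 4 / (2 * B 1)"
      using B1 by (simp add: pos_le_divide_eq)
    then show ?thesis using inN_mono[OF N, of s v] s v by linarith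
  qed
  then show ?thesis using that by blast
qed

end

section \<open>Necessary conditions from varying \<open>L\<close> and \<alpha>\<close>

context
  fixes L :: real and \<alpha> :: "real \<Rightarrow> real"
  assumes K: "inK L \<alpha>"
begin

lemma continuous_on_gfun: "continuous_on {0..1} (gfun \<gamma> h L \<alpha>)"
  unfolding gfun_def[abs_def]
  using K by (intro continuous_on_tail_integral continuous_on_gbar) (auto simp: inK_def)

lemma is_minimizer_imp_gbar_1:
  assumes "is_minimizer \<gamma> h L \<alpha>"
  shows "gbar \<gamma> h L \<alpha> 1 = 0"
proof -
  \<comment> \<open>Half of the gap at 1, so that \<open>L\<close> can be moved by \<open>d\<close>
    in both directions with \<alpha> fixed; the two signs force \<open>gbar\<close> to vanish at
    1.\<close>
  define d where "d = (L - integral {0..1} \<alpha>) / 2"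
  have d: "0 < d" using K by (simp add: d_def inK_def)
  have K1: "inK (L + d) \<alpha>" using K d by (auto simp: inK_def)
  have "0 < L - d" using K inK_gap_le[OF K, of 1] d by (simp add: d_def inK_def)
  moreover have "L - d = integral {0..1} \<alpha> + d" by (simp add: d_def field_simps)
  ultimately have K2: "inK (L - d) \<alpha>" using K d by (simp add: inK_def)
  have "0 \<le> gbar \<gamma> h L \<alpha> 1 * d" "0 \<le> gbar \<gamma> h L \<alpha> 1 * (- d)"
    using assms K1 K2 Qdir_eq[OF K K1] Qdir_eq[OF K K2] is_minimizer_iff_Qdir_nonneg[OF K] by force+
  then show ?thesis using d by (simp add: zero_le_mult_iff mult_le_0_iff)
qed

lemma is_minimizer_imp_gfun_nonneg:
  assumes min: "is_minimizer \<gamma> h L \<alpha>" and u: "u \<in> {0..1}"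
  shows "0 \<le> gfun \<gamma> h L \<alpha> u"
proof (cases "u = 1")
  case False
  have N: "inN \<alpha>" "\<alpha> integrable_on {0..1}" using K by (auto simp: inK_def)
  define d where "d = (L - integral {0..1} \<alpha>) / 2"
  have d: "0 < d" using K by (simp add: d_def inK_def)
  \<comment> \<open>The jump is placed at the closed end \<open>u\<close> to keep right-continuity.
    It adds at most \<open>d\<close> to the integral, less than the gap at 1, and changes the
    integral against \<open>gbar\<close> by \<open>d * gfun \<gamma> h L \<alpha> u\<close>.\<close>
  let ?step = "\<lambda>s. if s \<in> {u..1} then d else 0"
  have step: "((\<lambda>s. if s \<in> {u..1} then f s else 0) has_integral integral {u..1} f) {0..1}"
    if "continuous_on {0..1} f" for f :: "real \<Rightarrow> real"
  proof -
    have "f integrable_on {u..1}"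
      using u by (intro integrable_continuous_real continuous_on_subset[OF that]) auto
    then show ?thesis
      using u by (subst has_integral_restrict) (auto simp: has_integral_integral)
  qed
  define \<alpha>' where "\<alpha>' s = \<alpha> s + ?step s" for s
  have int': "(\<alpha>' has_integral integral {0..1} \<alpha> + d * (1 - u)) {0..1}"
    using has_integral_add[OF integrable_integral[OF N(2)] step[of "\<lambda>_. d"]] u
    by (simp add: \<alpha>'_def[abs_def] mult.commute)
  have "d * (1 - u) \<le> d * 1" using d u by (intro mult_left_mono) auto
  then have "integral {0..1} \<alpha> + d * (1 - u) < L"
    using d by (simp add: d_def field_simps)
  moreover have "inN \<alpha>'"
    unfolding inN_def mono_on_def
  proof (intro conjI ballI allI impI)
    show "0 \<le> \<alpha>' s" if "s \<in> {0..<1}" for s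
      using inN_nonneg[OF N, of s] that d by (auto simp: \<alpha>'_def)
    show "\<alpha>' s \<le> \<alpha>' t" if "s \<in> {0..<1} \<and> t \<in> {0..<1} \<and> s \<le> t" for s t
      using inN_mono[OF N, of s t] that d by (auto simp: \<alpha>'_def)
    show "continuous (at_right s) \<alpha>'" if s: "s \<in> {0..<1}" for s
    proof -
      have "\<forall>\<^sub>F t in at_right s. ?step t = ?step s"
      proof (cases "u \<le> s")
        case True
        then show ?thesis
          using s by (intro eventually_mono[OF eventually_at_right_real[of s 1]]) auto
      next
        case False
        then show ?thesis
          by (intro eventually_mono[OF eventually_at_right_real[of s u]]) auto
      qed
      then have "(?step \<longlongrightarrow> ?step s) (at_right s)"
        by (rule tendsto_eventually)
      moreover have "(\<alpha> \<longlongrightarrow> \<alpha> s) (at_right s)"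
        using N(1) s by (auto simp: inN_def continuous_within)
      ultimately show ?thesis
        unfolding continuous_within \<alpha>'_def by (rule tendsto_add[rotated])
    qed
  qed
  ultimately have K': "inK L \<alpha>'"
    using K int' by (auto simp: inK_def integral_unique has_integral_integrable)
  have "((\<lambda>s. gbar \<gamma> h L \<alpha> s * \<alpha> s + d * (if s \<in> {u..1} then gbar \<gamma> h L \<alpha> s else 0)) has_integral
      integral {0..1} (\<lambda>s. gbar \<gamma> h L \<alpha> s * \<alpha> s) + d * gfun \<gamma> h L \<alpha> u) {0..1}"
    unfolding gfun_def
    by (intro has_integral_add has_integral_mult_right step continuous_on_gbar[OF K]
      integrable_integral continuous_mult_inN_integrable N)
  moreover have "(\<lambda>s. gbar \<gamma> h L \<alpha> s * \<alpha> s + d * (if s \<in> {u..1} then gbar \<gamma> h L \<alpha> s else 0))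
    = (\<lambda>s. gbar \<gamma> h L \<alpha> s * \<alpha>' s)"
    by (auto simp: \<alpha>'_def algebra_simps)
  ultimately have "integral {0..1} (\<lambda>s. gbar \<gamma> h L \<alpha> s * \<alpha>' s)
    = integral {0..1} (\<lambda>s. gbar \<gamma> h L \<alpha> s * \<alpha> s) + d * gfun \<gamma> h L \<alpha> u"
    by (simp add: integral_unique)
  then have "Qdir L \<alpha> L \<alpha>' = d * gfun \<gamma> h L \<alpha> u"
    using Qdir_eq[OF K K'] is_minimizer_imp_gbar_1[OF min] by simp
  then have "0 \<le> d * gfun \<gamma> h L \<alpha> u"
    using min K' is_minimizer_iff_Qdir_nonneg[OF K] by metis
  then show ?thesis using d by (simp add: zero_le_mult_iff)
qed (simp add: gfun_def)

end

section \<open>The measure \<nu> and the zero set of \<open>gfun\<close>\<close>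

context
  fixes L :: real and \<alpha> :: "real \<Rightarrow> real" and \<nu> :: "real measure"
  assumes K: "inK L \<alpha>"
    and sets: "sets \<nu> = sets (restrict_space borel {0..<1})"
    and cdf: "\<forall>s\<in>{0..<1}. emeasure \<nu> {0..s} = ennreal (\<alpha> s)"
begin

lemma distribution_Icc: "0 \<le> s \<Longrightarrow> s < 1 \<Longrightarrow> emeasure \<nu> {0..s} = ennreal (\<alpha> s)"
  using cdf by simp

lemma gfun_zeros_measurable: "{u \<in> {0..<1}. gfun \<gamma> h L \<alpha> u = 0} \<in> sets \<nu>"
proof -
  have "closed ({0..1} \<inter> gfun \<gamma> h L \<alpha> -` {0})"
    by (intro continuous_closed_preimage continuous_on_gfun[OF K]) auto
  then have "{0..<1} \<inter> ({0..1} \<inter> gfun \<gamma> h L \<alpha> -` {0}) \<in> sets borel"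
    by (intro sets.Int[OF _ borel_closed]) simp_all
  also have "{0..<1} \<inter> ({0..1} \<inter> gfun \<gamma> h L \<alpha> -` {0}) = {u \<in> {0..<1}. gfun \<gamma> h L \<alpha> u = 0}"
    by auto
  finally show ?thesis by (intro sets_borel_unit[OF sets]) auto
qed

text \<open>
  If \<open>\<alpha>\<close> is unbounded, both sides of the hypothesis \<open>full\<close> could a priori be infinite without the
  complement of the zero set being null. This is excluded: infinite mass of the zero set makes it
  accumulate at \<open>1\<close>, which bounds \<open>\<alpha>\<close>.
\<close>

lemma gfun_zero_AE_of_full_measure:
  assumes nonneg: "\<And>u. u \<in> {0..1} \<Longrightarrow> 0 \<le> gfun \<gamma> h L \<alpha> u"
    and one: "gbar \<gamma> h L \<alpha> 1 = 0"
    and full: "emeasure \<nu> {u \<in> {0..<1}. gfun \<gamma> h L \<alpha> u = 0} = emeasure \<nu> {0..<1}"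
  shows "AE u in \<nu>. gfun \<gamma> h L \<alpha> u = 0"
proof -
  let ?S = "{u \<in> {0..<1}. gfun \<gamma> h L \<alpha> u = 0}"
  have fin: "emeasure \<nu> {0..<1} < \<infinity>"
  proof (cases "\<forall>t. 0 \<le> t \<and> t < 1 \<longrightarrow> (\<exists>u>t. u < 1 \<and> gfun \<gamma> h L \<alpha> u = 0)")
    case True
    then obtain M where M: "\<And>s. 0 \<le> s \<Longrightarrow> s < 1 \<Longrightarrow> \<alpha> s \<le> M"
      using inN_bounded_of_gfun_zeros_accumulate[OF K nonneg one] by blast
    show ?thesis by (rule distribution_finite_of_bounded[OF sets distribution_Icc M])
  next
    case False
    then obtain t where t: "0 \<le> t" "t < 1" and no: "\<And>u. t < u \<Longrightarrow> u < 1 \<Longrightarrow> gfun \<gamma> h L \<alpha> u \<noteq> 0"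
      by blast
    have "u \<le> t" if "u \<in> ?S" for u
      using no[of u] that by (cases "t < u") auto
    then have "?S \<subseteq> {0..t}" by auto
    moreover have "{0..t} \<in> sets \<nu>" using t by (intro sets_borel_unit[OF sets]) auto
    ultimately have "emeasure \<nu> ?S \<le> ennreal (\<alpha> t)"
      using emeasure_mono[of ?S "{0..t}" \<nu>] distribution_Icc t by simp
    then show ?thesis
      using le_less_trans[OF _ ennreal_less_top] full by simp
  qed
  have meas: "{0..<1} \<in> sets \<nu>" by (rule sets_borel_unit[OF sets]) auto
  \<comment> \<open>Finiteness of the total mass makes the difference of the two equal masses
    0.\<close>
  have "emeasure \<nu> ({0..<1} - ?S) = emeasure \<nu> {0..<1} - emeasure \<nu> ?S"
    using fin full gfun_zeros_measurable meas by (intro emeasure_Diff) auto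
  also have "\<dots> = 0" using fin full by (simp add: ennreal_minus_cancel_iff less_top)
  finally have "{0..<1} - ?S \<in> null_sets \<nu>"
    using gfun_zeros_measurable meas by (intro null_setsI) auto
  then show ?thesis
    by (rule AE_I') (auto simp: space_borel_unit[OF sets])
qed

text \<open>The Fubini lemma for \<open>gbar\<close>, whose tail integral is \<open>gfun\<close>.
  Integrability of \<alpha> supplies the finiteness condition, so \<open>gfun\<close> is integrable
  even when \<nu> has infinite mass.\<close>

lemma integral_gbar_mult_distribution:
  "integrable \<nu> (gfun \<gamma> h L \<alpha>)"
  "integral {0..1} (\<lambda>u. gbar \<gamma> h L \<alpha> u * \<alpha> u) = (\<integral>u. gfun \<gamma> h L \<alpha> u \<partial>\<nu>)"
proof -
  have N: "inN \<alpha>" "\<alpha> integrable_on {0..1}" using K by (auto simp: inK_def)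
  have fin: "(\<integral>\<^sup>+q. ennreal (indicator {0..<1} q * \<alpha> q) \<partial>lborel) < \<infinity>"
    using inN_nn_integral[OF N, of 1] by simp
  note * = integral_against_distribution_function[OF sets distribution_Icc inN_borel_measurable[OF N]
    inN_nonneg[OF N] fin continuous_on_gbar[OF K]]
  show "integrable \<nu> (gfun \<gamma> h L \<alpha>)"
    unfolding gfun_def[abs_def] using *(1) by simp
  show "integral {0..1} (\<lambda>u. gbar \<gamma> h L \<alpha> u * \<alpha> u) = (\<integral>u. gfun \<gamma> h L \<alpha> u \<partial>\<nu>)"
    unfolding gfun_def using *(2) by simp
qed

text \<open>The direction towards the zero function with the same \<open>L\<close> gives that the
  integral of \<open>gfun\<close> against \<nu> is at most 0, while \<open>gfun\<close> is
  nonnegative.\<close>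

lemma is_minimizer_imp_gfun_zero_AE:
  assumes min: "is_minimizer \<gamma> h L \<alpha>"
  shows "AE u in \<nu>. gfun \<gamma> h L \<alpha> u = 0"
proof -
  have K0: "inK L (\<lambda>_. 0)" using K by (auto simp: inK_def inN_def mono_on_def)
  have "0 \<le> - integral {0..1} (\<lambda>u. gbar \<gamma> h L \<alpha> u * \<alpha> u)"
    using min K0 Qdir_eq[OF K K0] is_minimizer_iff_Qdir_nonneg[OF K] is_minimizer_imp_gbar_1[OF K min]
    by force
  moreover have ae: "AE u in \<nu>. 0 \<le> gfun \<gamma> h L \<alpha> u"
    using is_minimizer_imp_gfun_nonneg[OF K min] by (intro AE_I2) (auto simp: space_borel_unit[OF sets])
  moreover from this have "0 \<le> (\<integral>u. gfun \<gamma> h L \<alpha> u \<partial>\<nu>)"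
    by (rule integral_nonneg_AE)
  ultimately have "(\<integral>u. gfun \<gamma> h L \<alpha> u \<partial>\<nu>) = 0"
    using integral_gbar_mult_distribution(2) by linarith
  then show ?thesis
    using integral_nonneg_eq_0_iff_AE[OF integral_gbar_mult_distribution(1) ae] by simp
qed

text \<open>Two terms of \<open>Qdir_eq\<close> vanish by \<open>one\<close> and \<open>ae\<close>;
  the remaining integral of \<open>gbar\<close> against \<open>\<alpha>'\<close> is nonnegative
  because the tail integrals of \<open>gbar\<close> are.\<close>

lemma is_minimizerI:
  assumes one: "gbar \<gamma> h L \<alpha> 1 = 0"
    and nonneg: "\<And>u. u \<in> {0..1} \<Longrightarrow> 0 \<le> gfun \<gamma> h L \<alpha> u"
    and ae: "AE u in \<nu>. gfun \<gamma> h L \<alpha> u = 0"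
  shows "is_minimizer \<gamma> h L \<alpha>"
  unfolding is_minimizer_iff_Qdir_nonneg[OF K]
proof (intro allI impI)
  fix L' \<alpha>' assume K': "inK L' \<alpha>'"
  have "(\<integral>u. gfun \<gamma> h L \<alpha> u \<partial>\<nu>) = 0"
    using ae by (rule integral_eq_zero_AE)
  moreover have "0 \<le> integral {0..1} (\<lambda>u. gbar \<gamma> h L \<alpha> u * \<alpha>' u)"
    using K' nonneg unfolding gfun_def
    by (intro integral_mult_inN_nonneg continuous_on_gbar[OF K]) (auto simp: inK_def)
  ultimately show "0 \<le> Qdir L \<alpha> L' \<alpha>'"
    unfolding Qdir_eq[OF K K'] one integral_gbar_mult_distribution(2) by simp
qed

end

end

theorem theorem2:
  fixes \<gamma> :: "nat \<Rightarrow> real" and h L :: real and \<alpha> :: "real \<Rightarrow> real"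
    and \<nu> :: "real measure"
  assumes summ: "summable (\<lambda>p. 2 ^ p * (\<gamma> p)\<^sup>2)"
    and K: "inK L \<alpha>"
    and \<nu>_sets: "sets \<nu> = sets (restrict_space borel {0..<1})"
    and \<nu>_def: "\<forall>s\<in>{0..<1}. emeasure \<nu> {0..s} = ennreal (\<alpha> s)"
  shows "is_minimizer \<gamma> h L \<alpha> \<longleftrightarrow>
     (deriv (xi \<gamma>) 1 + h\<^sup>2 = integral {0..1} (\<lambda>q. 1 / (L - integral {0..q} \<alpha>)\<^sup>2)
      \<and> (\<forall>u\<in>{0..1}. 0 \<le> gfun \<gamma> h L \<alpha> u)
      \<and> emeasure \<nu> {u\<in>{0..<1}. gfun \<gamma> h L \<alpha> u = 0} = emeasure \<nu> {0..<1})"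
proof -
  interpret mixed_p_spin \<gamma> h by unfold_locales (rule summ)
  note facts = K \<nu>_sets \<nu>_def
  have one: "gbar \<gamma> h L \<alpha> 1 = 0 \<longleftrightarrow>
      deriv (xi \<gamma>) 1 + h\<^sup>2 = integral {0..1} (\<lambda>q. 1 / (L - integral {0..q} \<alpha>)\<^sup>2)"
    by (simp add: gbar_def)
  show ?thesis
    unfolding one[symmetric]
  proof (intro iffI conjI ballI)
    assume min: "is_minimizer \<gamma> h L \<alpha>"
    show "gbar \<gamma> h L \<alpha> 1 = 0"
      by (rule is_minimizer_imp_gbar_1[OF K min])
    show "0 \<le> gfun \<gamma> h L \<alpha> u" if "u \<in> {0..1}" for u
      by (rule is_minimizer_imp_gfun_nonneg[OF K min that])
    \<comment> \<open>Almost everywhere vanishing gives equality of the two masses, whether they are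
      finite or infinite.\<close>
    have "AE u in \<nu>. u \<in> {u\<in>{0..<1}. gfun \<gamma> h L \<alpha> u = 0} \<longleftrightarrow> u \<in> {0..<1}"
      using is_minimizer_imp_gfun_zero_AE[OF facts min] by eventually_elim auto
    then show "emeasure \<nu> {u\<in>{0..<1}. gfun \<gamma> h L \<alpha> u = 0} = emeasure \<nu> {0..<1}"
      using gfun_zeros_measurable[OF facts] sets_borel_unit[OF \<nu>_sets, of "{0..<1}"]
      by (intro emeasure_eq_AE) auto
  next
    assume "gbar \<gamma> h L \<alpha> 1 = 0 \<and> (\<forall>u\<in>{0..1}. 0 \<le> gfun \<gamma> h L \<alpha> u) \<and>
      emeasure \<nu> {u\<in>{0..<1}. gfun \<gamma> h L \<alpha> u = 0} = emeasure \<nu> {0..<1}"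
    then show "is_minimizer \<gamma> h L \<alpha>"
      using is_minimizerI[OF facts] gfun_zero_AE_of_full_measure[OF facts] by blast
  qed
qed

end
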